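(* Let $(X,\mu,\mathcal{E},\mathcal{F})$ be a Dirichlet space with $\mu(X)=1$ and conservative heat semigroup $\{P_t\}_{t\in[0,\infty)}$. Assume that $\mathcal E$ satisfies a spectral gap inequality with spectral gap $\lambda_1>0$: for every $f\in\mathcal F$, $$\int_Xf^2\,d\mu-\left(\int_Xf\,d\mu\right)^2\le\frac1{\lambda_1}\mathcal E(f,f).$$ For $\alpha\in(0,1]$ define the $\alpha$-Cheeger constant $$h_\alpha=\inf\frac{\|\mathbf 1_E\|_{1,\alpha}}{\mu(E)},$$ where the infimum runs over all measurable sets $E$ such that $0<\mu(E)\le\frac12$ and $\mathbf 1_E\in\mathbf B^{1,\alpha}(X)$. Then $$h_\alpha\ge(1-e^{-1})\lambda_1^\alpha.$$
   Context: $X$ is a good measurable space (the measure decomposition theorem holds and the $\sigma$-algebra is generated by a countable family; e.g. a Polish space) with a $\sigma$-finite measure $\mu$. A Dirichlet form is a densely defined closed symmetric form $(\mathcal{E},\mathcal{F})$ on $L^2(X,\mu)$ which is Markovian: if $u\in\mathcal F$ and $v$ satisfies $|v(x)-v(y)|\le|u(x)-u(y)|$ and $|v(x)|\le|u(x)|$ for a.e. $x,y$, then $v\in\mathcal F$ and $\mathcal E(v,v)\le\mathcal E(u,u)$. Then $(X,\mu,\mathcal E,\mathcal F)$ is called a Dirichlet space. $\{P_t\}_{t\ge0}$ is the associated self-adjoint sub-Markovian semigroup on $L^2(X,\mu)$ (the heat semigroup), extended to a contraction semigroup on every $L^p(X,\mu)$, $1\le p\le\infty$. It is conservative if $P_t1=1$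 for all $t$; then there are probability kernels $p_t(x,dy)$ with $P_tf(x)=\int_Xf(y)\,p_t(x,dy)$ for bounded or non-negative measurable $f$. For $f\in L^1(X,\mu)$, $$\|f\|_{1,\alpha}=\sup_{t>0}t^{-\alpha}\int_X\int_X|f(x)-f(y)|\,p_t(y,dx)\,d\mu(y),$$ and $\mathbf B^{1,\alpha}(X)=\{f\in L^1(X,\mu):\|f\|_{1,\alpha}<+\infty\}$. The infimum over an empty family is $+\infty$. *)

theory Defs
  imports "HOL-Probability.Probability"
begin

text \<open>
  Elements of \<open>L\<^sup>2(X, \<mu>)\<close> are represented by real-valued functions; identities between them hold
  almost everywhere.
\<close>

definition L2_space :: "'a measure \<Rightarrow> ('a \<Rightarrow> real) set" where
  "L2_space M = {f \<in> borel_measurable M. integrable M (\<lambda>x. (f x)\<^sup>2)}"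

definition L2_inner :: "'a measure \<Rightarrow> ('a \<Rightarrow> real) \<Rightarrow> ('a \<Rightarrow> real) \<Rightarrow> real" where
  "L2_inner M f g = (\<integral>x. f x * g x \<partial>M)"

definition L2_norm :: "'a measure \<Rightarrow> ('a \<Rightarrow> real) \<Rightarrow> real" where
  "L2_norm M f = sqrt (\<integral>x. (f x)\<^sup>2 \<partial>M)"

text \<open>
  Only the \<open>\<sigma>\<close>-algebra of \<open>M\<close> is relevant here. The second conjunct is the measure decomposition
  theorem: \<open>\<nu>(dx, dy) = \<kappa>(x, dy) \<nu>\<^sub>1(dx)\<close> with \<open>\<nu>\<^sub>1\<close> the first marginal of \<open>\<nu>\<close>.
\<close>

definition good_measurable_space :: "'a measure \<Rightarrow> bool" where
  "good_measurable_space M \<longleftrightarrow>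
     (\<exists>C. countable C \<and> C \<subseteq> Pow (space M) \<and> sets M = sigma_sets (space M) C) \<and>
     (\<forall>\<nu>. prob_space \<nu> \<longrightarrow> sets \<nu> = sets (M \<Otimes>\<^sub>M M) \<longrightarrow>
        (\<exists>\<kappa> \<in> measurable M (prob_algebra M). \<forall>A \<in> sets (M \<Otimes>\<^sub>M M).
           emeasure \<nu> A = (\<integral>\<^sup>+ x. emeasure (\<kappa> x) (Pair x -` A) \<partial>(distr \<nu> M fst))))"

text \<open>
  A symmetric form is a non-negative symmetric bilinear form on a linear subspace \<open>\<F>\<close> of
  \<open>L\<^sup>2\<close>. The last two conjuncts say that \<open>\<F>\<close> and \<open>\<E>\<close> live on almost-everywhere classes.
\<close>

definition symmetric_form ::
  "'a measure \<Rightarrow> ('a \<Rightarrow> real) set \<Rightarrow> (('a \<Rightarrow> real) \<Rightarrow> ('a \<Rightarrow> real) \<Rightarrow> real) \<Rightarrow> bool" where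
  "symmetric_form M \<F> \<E> \<longleftrightarrow>
     \<F> \<subseteq> L2_space M \<and> (\<lambda>x. 0) \<in> \<F> \<and>
     (\<forall>u\<in>\<F>. \<forall>v\<in>\<F>. \<forall>a b. (\<lambda>x. a * u x + b * v x) \<in> \<F>) \<and>
     (\<forall>u\<in>\<F>. \<forall>v\<in>\<F>. \<forall>w\<in>\<F>. \<forall>a b. \<E> (\<lambda>x. a * u x + b * v x) w = a * \<E> u w + b * \<E> v w) \<and>
     (\<forall>u\<in>\<F>. \<forall>v\<in>\<F>. \<E> u v = \<E> v u) \<and>
     (\<forall>u\<in>\<F>. 0 \<le> \<E> u u) \<and>
     (\<forall>u\<in>\<F>. \<forall>v \<in> borel_measurable M. (AE x in M. v x = u x) \<longrightarrow> v \<in> \<F>) \<and>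
     (\<forall>u\<in>\<F>. \<forall>v\<in>\<F>. \<forall>w\<in>\<F>. (AE x in M. v x = u x) \<longrightarrow> \<E> v w = \<E> u w)"

definition densely_defined :: "'a measure \<Rightarrow> ('a \<Rightarrow> real) set \<Rightarrow> bool" where
  "densely_defined M \<F> \<longleftrightarrow>
     (\<forall>f \<in> L2_space M. \<forall>e>0. \<exists>u\<in>\<F>. L2_norm M (\<lambda>x. f x - u x) < e)"

definition form_norm_sq ::
  "'a measure \<Rightarrow> (('a \<Rightarrow> real) \<Rightarrow> ('a \<Rightarrow> real) \<Rightarrow> real) \<Rightarrow> ('a \<Rightarrow> real) \<Rightarrow> real" where
  "form_norm_sq M \<E> u = \<E> u u + (L2_norm M u)\<^sup>2"

definition closed_form ::
  "'a measure \<Rightarrow> ('a \<Rightarrow> real) set \<Rightarrow> (('a \<Rightarrow> real) \<Rightarrow> ('a \<Rightarrow> real) \<Rightarrow> real) \<Rightarrow> bool" where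
  "closed_form M \<F> \<E> \<longleftrightarrow>
     (\<forall>u :: nat \<Rightarrow> 'a \<Rightarrow> real. (\<forall>n. u n \<in> \<F>) \<longrightarrow>
        (\<forall>e>0. \<exists>N. \<forall>m\<ge>N. \<forall>n\<ge>N. form_norm_sq M \<E> (\<lambda>x. u m x - u n x) < e) \<longrightarrow>
        (\<exists>v\<in>\<F>. (\<lambda>n. form_norm_sq M \<E> (\<lambda>x. u n x - v x)) \<longlonglongrightarrow> 0))"

definition Markovian_form ::
  "'a measure \<Rightarrow> ('a \<Rightarrow> real) set \<Rightarrow> (('a \<Rightarrow> real) \<Rightarrow> ('a \<Rightarrow> real) \<Rightarrow> real) \<Rightarrow> bool" where
  "Markovian_form M \<F> \<E> \<longleftrightarrow>
     (\<forall>u\<in>\<F>. \<forall>v \<in> borel_measurable M.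
        (AE (x, y) in M \<Otimes>\<^sub>M M. \<bar>v x - v y\<bar> \<le> \<bar>u x - u y\<bar>) \<longrightarrow>
        (AE x in M. \<bar>v x\<bar> \<le> \<bar>u x\<bar>) \<longrightarrow>
        v \<in> \<F> \<and> \<E> v v \<le> \<E> u u)"

definition Dirichlet_form ::
  "'a measure \<Rightarrow> ('a \<Rightarrow> real) set \<Rightarrow> (('a \<Rightarrow> real) \<Rightarrow> ('a \<Rightarrow> real) \<Rightarrow> real) \<Rightarrow> bool" where
  "Dirichlet_form M \<F> \<E> \<longleftrightarrow>
     symmetric_form M \<F> \<E> \<and> densely_defined M \<F> \<and> closed_form M \<F> \<E> \<and> Markovian_form M \<F> \<E>"

definition Dirichlet_space ::
  "'a measure \<Rightarrow> ('a \<Rightarrow> real) set \<Rightarrow> (('a \<Rightarrow> real) \<Rightarrow> ('a \<Rightarrow> real) \<Rightarrow> real) \<Rightarrow> bool" where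
  "Dirichlet_space M \<F> \<E> \<longleftrightarrow>
     good_measurable_space M \<and> sigma_finite_measure M \<and> Dirichlet_form M \<F> \<E>"

text \<open>
  The self-adjoint operator \<open>L\<close> of the form, as a graph: \<open>f \<in> dom L\<close> and \<open>L f = h\<close> iff
  \<open>\<E>(f, g) = - \<langle>h, g\<rangle>\<close> for all \<open>g \<in> \<F>\<close>.
\<close>

definition form_generator ::
  "'a measure \<Rightarrow> ('a \<Rightarrow> real) set \<Rightarrow> (('a \<Rightarrow> real) \<Rightarrow> ('a \<Rightarrow> real) \<Rightarrow> real) \<Rightarrow>
   ('a \<Rightarrow> real) \<Rightarrow> ('a \<Rightarrow> real) \<Rightarrow> bool" where
  "form_generator M \<F> \<E> f h \<longleftrightarrow>
     f \<in> \<F> \<and> h \<in> L2_space M \<and> (\<forall>g\<in>\<F>. \<E> f g = - L2_inner M h g)"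

definition semigroup_generator ::
  "'a measure \<Rightarrow> (real \<Rightarrow> ('a \<Rightarrow> real) \<Rightarrow> 'a \<Rightarrow> real) \<Rightarrow> ('a \<Rightarrow> real) \<Rightarrow> ('a \<Rightarrow> real) \<Rightarrow> bool" where
  "semigroup_generator M P f h \<longleftrightarrow>
     f \<in> L2_space M \<and> h \<in> L2_space M \<and>
     ((\<lambda>t. L2_norm M (\<lambda>x. (P t f x - f x) / t - h x)) \<longlongrightarrow> 0) (at_right 0)"

definition selfadjoint_semigroup ::
  "'a measure \<Rightarrow> (real \<Rightarrow> ('a \<Rightarrow> real) \<Rightarrow> 'a \<Rightarrow> real) \<Rightarrow> bool" where
  "selfadjoint_semigroup M P \<longleftrightarrow>
     (\<forall>t\<ge>0. \<forall>f \<in> L2_space M. P t f \<in> L2_space M) \<and>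
     (\<forall>t\<ge>0. \<forall>f \<in> L2_space M. \<forall>g \<in> L2_space M.
        (AE x in M. f x = g x) \<longrightarrow> (AE x in M. P t f x = P t g x)) \<and>
     (\<forall>t\<ge>0. \<forall>f \<in> L2_space M. \<forall>g \<in> L2_space M. \<forall>a b.
        AE x in M. P t (\<lambda>y. a * f y + b * g y) x = a * P t f x + b * P t g x) \<and>
     (\<forall>t\<ge>0. \<forall>f \<in> L2_space M. L2_norm M (P t f) \<le> L2_norm M f) \<and>
     (\<forall>t\<ge>0. \<forall>f \<in> L2_space M. \<forall>g \<in> L2_space M. L2_inner M (P t f) g = L2_inner M f (P t g)) \<and>
     (\<forall>f \<in> L2_space M. AE x in M. P 0 f x = f x) \<and>
     (\<forall>s\<ge>0. \<forall>t\<ge>0. \<forall>f \<in> L2_space M. AE x in M. P (s + t) f x = P s (P t f) x) \<and>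
     (\<forall>f \<in> L2_space M. ((\<lambda>t. L2_norm M (\<lambda>x. P t f x - f x)) \<longlongrightarrow> 0) (at_right 0))"

definition sub_Markovian :: "'a measure \<Rightarrow> (real \<Rightarrow> ('a \<Rightarrow> real) \<Rightarrow> 'a \<Rightarrow> real) \<Rightarrow> bool" where
  "sub_Markovian M P \<longleftrightarrow>
     (\<forall>t\<ge>0. \<forall>f \<in> L2_space M. (AE x in M. 0 \<le> f x \<and> f x \<le> 1) \<longrightarrow>
        (AE x in M. 0 \<le> P t f x \<and> P t f x \<le> 1))"

text \<open>
  \<open>P\<^sub>t = exp (t L)\<close>, expressed by the equality of the infinitesimal generator of the semigroup
  with the operator of the form; this determines the semigroup.
\<close>

definition heat_semigroup ::
  "'a measure \<Rightarrow> ('a \<Rightarrow> real) set \<Rightarrow> (('a \<Rightarrow> real) \<Rightarrow> ('a \<Rightarrow> real) \<Rightarrow> real) \<Rightarrow>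
   (real \<Rightarrow> ('a \<Rightarrow> real) \<Rightarrow> 'a \<Rightarrow> real) \<Rightarrow> bool" where
  "heat_semigroup M \<F> \<E> P \<longleftrightarrow>
     selfadjoint_semigroup M P \<and> sub_Markovian M P \<and>
     (\<forall>f h. semigroup_generator M P f h \<longleftrightarrow> form_generator M \<F> \<E> f h)"

text \<open>
  The following two definitions are meant for finite \<open>M\<close>, where bounded measurable functions belong
  to \<open>L\<^sup>2\<close> and the extension of \<open>P\<^sub>t\<close> to \<open>L\<^sup>\<infinity>\<close> is the restriction of the operator on \<open>L\<^sup>2\<close>.
  The extension of the kernel representation to non-negative measurable functions is by monotone limits.
\<close>

definition conservative :: "'a measure \<Rightarrow> (real \<Rightarrow> ('a \<Rightarrow> real) \<Rightarrow> 'a \<Rightarrow> real) \<Rightarrow> bool" where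
  "conservative M P \<longleftrightarrow> (\<forall>t\<ge>0. AE x in M. P t (\<lambda>_. 1) x = 1)"

definition heat_kernel ::
  "'a measure \<Rightarrow> (real \<Rightarrow> ('a \<Rightarrow> real) \<Rightarrow> 'a \<Rightarrow> real) \<Rightarrow> (real \<Rightarrow> 'a \<Rightarrow> 'a measure) \<Rightarrow> bool" where
  "heat_kernel M P p \<longleftrightarrow>
     (\<forall>t\<ge>0. p t \<in> measurable M (prob_algebra M)) \<and>
     (\<forall>t\<ge>0. \<forall>f \<in> borel_measurable M. (\<exists>B. \<forall>x \<in> space M. \<bar>f x\<bar> \<le> B) \<longrightarrow>
        (AE x in M. P t f x = (\<integral>y. f y \<partial>(p t x))))"

definition spectral_gap ::
  "'a measure \<Rightarrow> ('a \<Rightarrow> real) set \<Rightarrow> (('a \<Rightarrow> real) \<Rightarrow> ('a \<Rightarrow> real) \<Rightarrow> real) \<Rightarrow> real \<Rightarrow> bool" where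
  "spectral_gap M \<F> \<E> l \<longleftrightarrow> l > 0 \<and>
     (\<forall>f\<in>\<F>. (\<integral>x. (f x)\<^sup>2 \<partial>M) - (\<integral>x. f x \<partial>M)\<^sup>2 \<le> 1 / l * \<E> f f)"

definition Besov_seminorm ::
  "'a measure \<Rightarrow> (real \<Rightarrow> 'a \<Rightarrow> 'a measure) \<Rightarrow> real \<Rightarrow> ('a \<Rightarrow> real) \<Rightarrow> ennreal" where
  "Besov_seminorm M p \<alpha> f =
     (SUP t\<in>{0<..}. ennreal (t powr (- \<alpha>)) *
        (\<integral>\<^sup>+ y. (\<integral>\<^sup>+ x. ennreal \<bar>f x - f y\<bar> \<partial>(p t y)) \<partial>M))"

definition Besov_space ::
  "'a measure \<Rightarrow> (real \<Rightarrow> 'a \<Rightarrow> 'a measure) \<Rightarrow> real \<Rightarrow> ('a \<Rightarrow> real) set" where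
  "Besov_space M p \<alpha> = {f. integrable M f \<and> Besov_seminorm M p \<alpha> f < \<infinity>}"

definition Cheeger_constant ::
  "'a measure \<Rightarrow> (real \<Rightarrow> 'a \<Rightarrow> 'a measure) \<Rightarrow> real \<Rightarrow> ennreal" where
  "Cheeger_constant M p \<alpha> =
     (INF A \<in> {A \<in> sets M. 0 < emeasure M A \<and> emeasure M A \<le> ennreal (1 / 2) \<and>
                 (indicator A :: 'a \<Rightarrow> real) \<in> Besov_space M p \<alpha>}.
        Besov_seminorm M p \<alpha> (indicator A) / emeasure M A)"

end

theory Submission imports Defs begin

text \<open>
  For a set \<open>A\<close> of measure at most \<open>1/2\<close>, conservativeness and symmetry turn the double integral in
  the seminorm of \<open>\<one>\<^sub>A\<close> into \<open>2 (\<mu>(A) - \<langle>P\<^sub>t \<one>\<^sub>A, \<one>\<^sub>A\<rangle>)\<close>. The spectral gap gives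
  \<open>\<langle>P\<^sub>t \<one>\<^sub>A, \<one>\<^sub>A\<rangle> - \<mu>(A)\<^sup>2 \<le> exp (- \<lambda>\<^sub>1 t) (\<mu>(A) - \<mu>(A)\<^sup>2)\<close>, so the integral is at least
  \<open>(1 - exp (- \<lambda>\<^sub>1 t)) \<mu>(A)\<close>, and the time \<open>t = 1/\<lambda>\<^sub>1\<close> yields the bound.
  The exponential decay is a Gronwall argument for functions in the domain of the generator;
  this domain is dense because the resolvents \<open>\<beta> (\<beta> - L)\<^sup>-\<^sup>1 f\<close>, obtained by minimising
  \<open>\<E>(u, u) + \<beta> \<parallel>u - f\<parallel>\<^sup>2\<close>, converge to \<open>f\<close> as \<open>\<beta>\<close> grows.
\<close>

section \<open>Elementary facts on real quadratics and null limits\<close>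

text \<open>For \<open>q > 0\<close> evaluate at the vertex \<open>s = - a / q\<close>; for
  \<open>q = 0\<close> an affine function that is bounded below on the whole line has slope 0. Both
  Cauchy-Schwarz inequalities and the estimate for almost minimisers rest on this.\<close>

lemma nonneg_quadratic_imp_discriminant_le:
  fixes a e q :: real
  assumes nonneg: "\<And>s. 0 \<le> e + 2 * s * a + s\<^sup>2 * q" and q: "0 \<le> q"
  shows "a\<^sup>2 \<le> e * q"
proof (cases "q = 0")
  case True
  have "a = 0"
  proof (rule ccontr)
    assume "a \<noteq> 0"
    \<comment> \<open>At this \<open>s\<close> the affine function takes the value
      \<open>e - (e + 1) = - 1\<close>.\<close>
    with nonneg[of "- (e + 1) / (2 * a)"] True show False by (simp add: field_simps)
  qed
  with True show ?thesis by simp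
next
  case False
  with q have "q > 0" by simp
  with nonneg[of "- a / q"] have "0 \<le> e - a\<^sup>2 / q"
    by (simp add: power2_eq_square field_simps)
  with \<open>q > 0\<close> show ?thesis by (simp add: field_simps)
qed

lemma tendsto_0_if_square_le:
  fixes a b :: "'b \<Rightarrow> real"
  assumes le: "\<And>n. (a n)\<^sup>2 \<le> b n" and lim: "(b \<longlongrightarrow> 0) F"
  shows "(a \<longlongrightarrow> 0) F"
proof -
  have "((\<lambda>n. (a n)\<^sup>2) \<longlongrightarrow> 0) F"
    by (rule Lim_null_comparison[OF _ lim]) (simp add: le)
  then show ?thesis by simp
qed

subsection \<open>The semi-inner product on square-integrable functions\<close>

lemma L2_space_measurable [measurable_dest]: "f \<in> L2_space M \<Longrightarrow> f \<in> borel_measurable M"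
  by (simp add: L2_space_def)

lemma L2_space_integrable_square: "f \<in> L2_space M \<Longrightarrow> integrable M (\<lambda>x. (f x)\<^sup>2)"
  by (simp add: L2_space_def)

lemma L2_space_integrable_mult:
  assumes f: "f \<in> L2_space M" and g: "g \<in> L2_space M"
  shows "integrable M (\<lambda>x. f x * g x)"
proof (rule Bochner_Integration.integrable_bound)
  show "integrable M (\<lambda>x. (f x)\<^sup>2 + (g x)\<^sup>2)"
    using f g by (intro Bochner_Integration.integrable_add L2_space_integrable_square)
  show "(\<lambda>x. f x * g x) \<in> borel_measurable M"
    using f g by measurable
  have "\<bar>a * b\<bar> \<le> a\<^sup>2 + b\<^sup>2" for a b :: real
  proof -
    have "0 \<le> (\<bar>a\<bar> - \<bar>b\<bar>)\<^sup>2" by simp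
    then have "2 * (\<bar>a\<bar> * \<bar>b\<bar>) \<le> a\<^sup>2 + b\<^sup>2" by (simp add: power2_diff mult.assoc)
    moreover have "0 \<le> \<bar>a\<bar> * \<bar>b\<bar>" by simp
    ultimately show ?thesis unfolding abs_mult by linarith
  qed
  then show "AE x in M. norm (f x * g x) \<le> norm ((f x)\<^sup>2 + (g x)\<^sup>2)"
    by (simp add: abs_mult)
qed

lemma L2_space_lincomb:
  assumes f: "f \<in> L2_space M" and g: "g \<in> L2_space M"
  shows "(\<lambda>x. a * f x + b * g x) \<in> L2_space M"
proof -
  have "integrable M (\<lambda>x. a\<^sup>2 * (f x)\<^sup>2 + 2 * a * b * (f x * g x) + b\<^sup>2 * (g x)\<^sup>2)"
    using f g by (intro Bochner_Integration.integrable_add integrable_mult_right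
        L2_space_integrable_square L2_space_integrable_mult)
  moreover have "(\<lambda>x. a\<^sup>2 * (f x)\<^sup>2 + 2 * a * b * (f x * g x) + b\<^sup>2 * (g x)\<^sup>2)
      = (\<lambda>x. (a * f x + b * g x)\<^sup>2)"
    by (simp add: fun_eq_iff power2_eq_square algebra_simps)
  moreover have "(\<lambda>x. a * f x + b * g x) \<in> borel_measurable M"
    using f g by measurable
  ultimately show ?thesis by (simp add: L2_space_def)
qed

lemma L2_space_diff:
  "f \<in> L2_space M \<Longrightarrow> g \<in> L2_space M \<Longrightarrow> (\<lambda>x. f x - g x) \<in> L2_space M"
  using L2_space_lincomb[of f M g 1 "-1"] by simp

lemma L2_inner_commute: "L2_inner M f g = L2_inner M g f"
  by (simp add: L2_inner_def mult.commute)

lemma L2_inner_lincomb_left: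
  assumes "f \<in> L2_space M" "g \<in> L2_space M" "h \<in> L2_space M"
  shows "L2_inner M (\<lambda>x. a * f x + b * g x) h = a * L2_inner M f h + b * L2_inner M g h"
proof -
  have "L2_inner M (\<lambda>x. a * f x + b * g x) h = (\<integral>x. a * (f x * h x) + b * (g x * h x) \<partial>M)"
    unfolding L2_inner_def by (intro Bochner_Integration.integral_cong) (auto simp: algebra_simps)
  also have "\<dots> = a * L2_inner M f h + b * L2_inner M g h"
    using assms by (simp add: L2_inner_def L2_space_integrable_mult)
  finally show ?thesis .
qed

lemma L2_inner_diff_left:
  assumes "f \<in> L2_space M" "g \<in> L2_space M" "h \<in> L2_space M"
  shows "L2_inner M (\<lambda>x. f x - g x) h = L2_inner M f h - L2_inner M g h"
  using L2_inner_lincomb_left[OF assms, of 1 "-1"] by simp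

lemma L2_inner_diff_right:
  assumes "f \<in> L2_space M" "g \<in> L2_space M" "h \<in> L2_space M"
  shows "L2_inner M h (\<lambda>x. f x - g x) = L2_inner M h f - L2_inner M h g"
  using L2_inner_diff_left[OF assms] by (simp add: L2_inner_commute)

text \<open>Linearity, the semigroup law and conservativeness are available only almost everywhere;
  this carries them into inner products.\<close>

lemma L2_inner_cong_AE:
  assumes "AE x in M. f x = f' x" "AE x in M. g x = g' x"
    and "f \<in> L2_space M" "f' \<in> L2_space M" "g \<in> L2_space M" "g' \<in> L2_space M"
  shows "L2_inner M f g = L2_inner M f' g'"
  unfolding L2_inner_def
proof (rule integral_cong_AE)
  show "(\<lambda>x. f x * g x) \<in> borel_measurable M" "(\<lambda>x. f' x * g' x) \<in> borel_measurable M"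
    using assms by measurable
  show "AE x in M. f x * g x = f' x * g' x"
    using assms(1,2) by eventually_elim simp
qed

lemma L2_inner_self: "L2_inner M f f = (L2_norm M f)\<^sup>2"
  by (simp add: L2_inner_def L2_norm_def power2_eq_square[symmetric])

lemma L2_norm_nonneg: "0 \<le> L2_norm M f"
  by (simp add: L2_norm_def)

lemma L2_norm_minus_commute: "L2_norm M (\<lambda>x. f x - g x) = L2_norm M (\<lambda>x. g x - f x)"
  by (simp add: L2_norm_def power2_commute)

lemma L2_norm_cong_AE:
  assumes "AE x in M. f x = g x" "f \<in> L2_space M" "g \<in> L2_space M"
  shows "L2_norm M f = L2_norm M g"
  using L2_inner_cong_AE[OF assms(1,1) assms(2,3) assms(2,3)]
  by (simp add: L2_inner_self power2_eq_iff_nonneg L2_norm_nonneg)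

lemma L2_norm_square_lincomb:
  assumes "f \<in> L2_space M" "g \<in> L2_space M"
  shows "(L2_norm M (\<lambda>x. a * f x + b * g x))\<^sup>2
    = a\<^sup>2 * (L2_norm M f)\<^sup>2 + 2 * a * b * L2_inner M f g + b\<^sup>2 * (L2_norm M g)\<^sup>2"
proof -
  have "L2_inner M (\<lambda>x. a * f x + b * g x) (\<lambda>x. a * f x + b * g x)
      = a * (a * L2_inner M f f + b * L2_inner M f g)
      + b * (a * L2_inner M f g + b * L2_inner M g g)"
    using assms
    by (simp add: L2_inner_lincomb_left L2_space_lincomb L2_inner_commute[of _ f "\<lambda>x. a * f x + b * g x"]
        L2_inner_commute[of _ g "\<lambda>x. a * f x + b * g x"] L2_inner_commute[of _ g f])
  then show ?thesis by (simp add: L2_inner_self power2_eq_square algebra_simps)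
qed

lemma L2_inner_Cauchy_Schwarz:
  assumes "f \<in> L2_space M" "g \<in> L2_space M"
  shows "\<bar>L2_inner M f g\<bar> \<le> L2_norm M f * L2_norm M g"
proof -
  have "0 \<le> (L2_norm M f)\<^sup>2 + 2 * s * L2_inner M f g + s\<^sup>2 * (L2_norm M g)\<^sup>2" for s
    using zero_le_power2[of "L2_norm M (\<lambda>x. 1 * f x + s * g x)"]
    unfolding L2_norm_square_lincomb[OF assms] by simp
  from nonneg_quadratic_imp_discriminant_le[OF this]
  have "\<bar>L2_inner M f g\<bar>\<^sup>2 \<le> (L2_norm M f * L2_norm M g)\<^sup>2"
    by (simp add: power_mult_distrib)
  then show ?thesis
    by (rule power2_le_imp_le) (simp add: L2_norm_nonneg)
qed

text \<open>The error splits into the pairing of the two differences and two pairings of one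
  difference with a limit; Cauchy-Schwarz bounds each. The filter is arbitrary because both
  sequences and the limit \<open>t\<close> to 0 from the right occur later.\<close>

lemma tendsto_L2_inner:
  assumes f: "\<And>n. f n \<in> L2_space M" "f' \<in> L2_space M"
    and g: "\<And>n. g n \<in> L2_space M" "g' \<in> L2_space M"
    and limf: "((\<lambda>n. L2_norm M (\<lambda>x. f n x - f' x)) \<longlongrightarrow> 0) F"
    and limg: "((\<lambda>n. L2_norm M (\<lambda>x. g n x - g' x)) \<longlongrightarrow> 0) F"
  shows "((\<lambda>n. L2_inner M (f n) (g n)) \<longlongrightarrow> L2_inner M f' g') F"
proof -
  let ?a = "\<lambda>n. L2_norm M (\<lambda>x. f n x - f' x)" and ?b = "\<lambda>n. L2_norm M (\<lambda>x. g n x - g' x)"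
  have "((\<lambda>n. ?a n * ?b n + ?a n * L2_norm M g' + L2_norm M f' * ?b n)
      \<longlongrightarrow> 0 * 0 + 0 * L2_norm M g' + L2_norm M f' * 0) F"
    by (intro tendsto_intros limf limg)
  then have lim: "((\<lambda>n. ?a n * ?b n + ?a n * L2_norm M g' + L2_norm M f' * ?b n) \<longlongrightarrow> 0) F"
    by simp
  have "((\<lambda>n. L2_inner M (f n) (g n) - L2_inner M f' g') \<longlongrightarrow> 0) F"
  proof (rule Lim_null_comparison[OF _ lim], rule always_eventually, rule allI)
    fix n
    have fd: "(\<lambda>x. f n x - f' x) \<in> L2_space M" and gd: "(\<lambda>x. g n x - g' x) \<in> L2_space M"
      using f g by (auto intro: L2_space_diff)
    have "L2_inner M (f n) (g n) - L2_inner M f' g'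
        = L2_inner M (\<lambda>x. f n x - f' x) (\<lambda>x. g n x - g' x)
        + L2_inner M (\<lambda>x. f n x - f' x) g' + L2_inner M f' (\<lambda>x. g n x - g' x)"
      using f g gd by (simp add: L2_inner_diff_left L2_inner_diff_right)
    moreover have "\<bar>L2_inner M (\<lambda>x. f n x - f' x) (\<lambda>x. g n x - g' x)\<bar> \<le> ?a n * ?b n"
      using fd gd by (rule L2_inner_Cauchy_Schwarz)
    moreover have "\<bar>L2_inner M (\<lambda>x. f n x - f' x) g'\<bar> \<le> ?a n * L2_norm M g'"
      using fd g(2) by (rule L2_inner_Cauchy_Schwarz)
    moreover have "\<bar>L2_inner M f' (\<lambda>x. g n x - g' x)\<bar> \<le> L2_norm M f' * ?b n"
      using f(2) gd by (rule L2_inner_Cauchy_Schwarz)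
    ultimately show "norm (L2_inner M (f n) (g n) - L2_inner M f' g')
        \<le> ?a n * ?b n + ?a n * L2_norm M g' + L2_norm M f' * ?b n"
      unfolding real_norm_def by linarith
  qed
  then show ?thesis by (simp add: LIM_zero_iff)
qed

lemma (in finite_measure) L2_space_bounded:
  assumes f: "f \<in> borel_measurable M" and B: "\<And>x. x \<in> space M \<Longrightarrow> \<bar>f x\<bar> \<le> B"
  shows "f \<in> L2_space M"
proof -
  have "integrable M (\<lambda>x. (f x)\<^sup>2)"
  proof (rule integrable_const_bound[where B = "B\<^sup>2"])
    show "AE x in M. norm ((f x)\<^sup>2) \<le> B\<^sup>2"
    proof (rule AE_I2)
      fix x assume "x \<in> space M"
      then have "\<bar>f x\<bar>\<^sup>2 \<le> B\<^sup>2" using B by (intro power_mono) auto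
      then show "norm ((f x)\<^sup>2) \<le> B\<^sup>2" by simp
    qed
  qed (use f in measurable)
  with f show ?thesis by (simp add: L2_space_def)
qed

subsection \<open>The domain of the generator of a closed form is dense\<close>

lemma symmetric_formD:
  assumes "symmetric_form M \<F> \<E>"
  shows "u \<in> \<F> \<Longrightarrow> u \<in> L2_space M"
    and "u \<in> \<F> \<Longrightarrow> v \<in> \<F> \<Longrightarrow> (\<lambda>x. a * u x + b * v x) \<in> \<F>"
    and "u \<in> \<F> \<Longrightarrow> v \<in> \<F> \<Longrightarrow> w \<in> \<F> \<Longrightarrow>
      \<E> (\<lambda>x. a * u x + b * v x) w = a * \<E> u w + b * \<E> v w"
    and "u \<in> \<F> \<Longrightarrow> v \<in> \<F> \<Longrightarrow> \<E> u v = \<E> v u"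
    and "u \<in> \<F> \<Longrightarrow> 0 \<le> \<E> u u"
proof -
  have D: "\<F> \<subseteq> L2_space M" "\<forall>u\<in>\<F>. \<forall>v\<in>\<F>. \<forall>a b. (\<lambda>x. a * u x + b * v x) \<in> \<F>"
    "\<forall>u\<in>\<F>. \<forall>v\<in>\<F>. \<forall>w\<in>\<F>. \<forall>a b. \<E> (\<lambda>x. a * u x + b * v x) w = a * \<E> u w + b * \<E> v w"
    "\<forall>u\<in>\<F>. \<forall>v\<in>\<F>. \<E> u v = \<E> v u" "\<forall>u\<in>\<F>. 0 \<le> \<E> u u"
    using assms unfolding symmetric_form_def by - (elim conjE, assumption)+
  show "u \<in> \<F> \<Longrightarrow> u \<in> L2_space M" by (rule subsetD[OF D(1)])
  show "u \<in> \<F> \<Longrightarrow> v \<in> \<F> \<Longrightarrow> (\<lambda>x. a * u x + b * v x) \<in> \<F>" using D(2) by blast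
  show "u \<in> \<F> \<Longrightarrow> v \<in> \<F> \<Longrightarrow> w \<in> \<F> \<Longrightarrow>
      \<E> (\<lambda>x. a * u x + b * v x) w = a * \<E> u w + b * \<E> v w" using D(3) by blast
  show "u \<in> \<F> \<Longrightarrow> v \<in> \<F> \<Longrightarrow> \<E> u v = \<E> v u" using D(4) by blast
  show "u \<in> \<F> \<Longrightarrow> 0 \<le> \<E> u u" using D(5) by blast
qed

lemma symmetric_form_square_lincomb:
  assumes form: "symmetric_form M \<F> \<E>" and u: "u \<in> \<F>" and v: "v \<in> \<F>"
  shows "\<E> (\<lambda>x. a * u x + b * v x) (\<lambda>x. a * u x + b * v x)
    = a\<^sup>2 * \<E> u u + 2 * a * b * \<E> u v + b\<^sup>2 * \<E> v v"
proof -
  note D = symmetric_formD[OF form]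
  let ?w = "\<lambda>x. a * u x + b * v x"
  have w: "?w \<in> \<F>" using u v by (rule D(2))
  have "\<E> ?w ?w = a * \<E> ?w u + b * \<E> ?w v"
    using D(3)[OF u v w] D(4)[OF u w] D(4)[OF v w] by simp
  also have "\<dots> = a * (a * \<E> u u + b * \<E> u v) + b * (a * \<E> u v + b * \<E> v v)"
    using D(3)[OF u v u] D(3)[OF u v v] D(4)[OF u v] by simp
  finally show ?thesis by (simp add: power2_eq_square algebra_simps)
qed

lemma symmetric_form_Cauchy_Schwarz:
  assumes form: "symmetric_form M \<F> \<E>" and u: "u \<in> \<F>" and v: "v \<in> \<F>"
  shows "(\<E> u v)\<^sup>2 \<le> \<E> u u * \<E> v v"
proof (rule nonneg_quadratic_imp_discriminant_le)
  fix s
  have "0 \<le> \<E> (\<lambda>x. 1 * u x + s * v x) (\<lambda>x. 1 * u x + s * v x)"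
    by (intro symmetric_formD(5)[OF form] symmetric_formD(2)[OF form u v])
  then show "0 \<le> \<E> u u + 2 * s * \<E> u v + s\<^sup>2 * \<E> v v"
    unfolding symmetric_form_square_lincomb[OF form u v] by simp
qed (use symmetric_formD(5)[OF form v] in simp)

section \<open>Resolvents as minimisers of a penalised energy\<close>

text \<open>The Euler-Lagrange equation of this functional over \<open>\<F>\<close> is the resolvent
  equation \<open>\<beta> u - L u = \<beta> f\<close>.\<close>

definition penalised_energy ::
  "'a measure \<Rightarrow> (('a \<Rightarrow> real) \<Rightarrow> ('a \<Rightarrow> real) \<Rightarrow> real) \<Rightarrow> real \<Rightarrow> ('a \<Rightarrow> real) \<Rightarrow> ('a \<Rightarrow> real) \<Rightarrow> real"
  where "penalised_energy M \<E> \<beta> f u = \<E> u u + \<beta> * (L2_norm M (\<lambda>x. u x - f x))\<^sup>2"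

text \<open>The expansion in \<open>s\<close> is exact because the functional is quadratic. The
  coefficient of \<open>2 * s\<close> is half the first variation at \<open>u\<close> in direction
  \<open>w\<close>.\<close>

lemma penalised_energy_lincomb:
  assumes form: "symmetric_form M \<F> \<E>" and f: "f \<in> L2_space M" and u: "u \<in> \<F>" and w: "w \<in> \<F>"
  shows "penalised_energy M \<E> \<beta> f (\<lambda>x. 1 * u x + s * w x) = penalised_energy M \<E> \<beta> f u
    + 2 * s * (\<E> u w + \<beta> * L2_inner M (\<lambda>x. u x - f x) w)
    + s\<^sup>2 * (\<E> w w + \<beta> * (L2_norm M w)\<^sup>2)"
proof -
  have L2: "(\<lambda>x. u x - f x) \<in> L2_space M" "w \<in> L2_space M"
    using f symmetric_formD(1)[OF form u] symmetric_formD(1)[OF form w] by (auto intro: L2_space_diff)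
  have "L2_norm M (\<lambda>x. (1 * u x + s * w x) - f x)
      = L2_norm M (\<lambda>x. 1 * (u x - f x) + s * w x)"
    by (simp add: algebra_simps)
  then have "(L2_norm M (\<lambda>x. (1 * u x + s * w x) - f x))\<^sup>2 = (L2_norm M (\<lambda>x. u x - f x))\<^sup>2
      + 2 * s * L2_inner M (\<lambda>x. u x - f x) w + s\<^sup>2 * (L2_norm M w)\<^sup>2"
    using L2_norm_square_lincomb[OF L2, of 1 s] by (simp add: add.assoc)
  then show ?thesis
    unfolding penalised_energy_def symmetric_form_square_lincomb[OF form u w]
    by (simp add: algebra_simps)
qed

text \<open>Expand the functional at \<open>v\<close> and at the midpoint around \<open>u\<close>,
  in direction \<open>w = v - u\<close>. In the combination on the right the linear terms cancel and
  one copy of the quadratic term remains, so \<open>f\<close> drops out.\<close>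

lemma penalised_energy_parallelogram:
  assumes form: "symmetric_form M \<F> \<E>" and f: "f \<in> L2_space M" and u: "u \<in> \<F>" and v: "v \<in> \<F>"
  shows "\<E> (\<lambda>x. u x - v x) (\<lambda>x. u x - v x) + \<beta> * (L2_norm M (\<lambda>x. u x - v x))\<^sup>2
    = 2 * penalised_energy M \<E> \<beta> f u + 2 * penalised_energy M \<E> \<beta> f v
      - 4 * penalised_energy M \<E> \<beta> f (\<lambda>x. 1/2 * u x + 1/2 * v x)"
proof -
  let ?w = "\<lambda>x. 1 * v x + (-1) * u x"
  have w: "?w \<in> \<F>" using v u by (rule symmetric_formD(2)[OF form])
  have wE: "\<E> (\<lambda>x. u x - v x) (\<lambda>x. u x - v x) = \<E> ?w ?w"
    using symmetric_form_square_lincomb[OF form u v, of 1 "-1"]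
      symmetric_form_square_lincomb[OF form v u, of 1 "-1"] symmetric_formD(4)[OF form u v] by simp
  have wN: "L2_norm M (\<lambda>x. u x - v x) = L2_norm M ?w"
    using L2_norm_minus_commute[of M u v] by simp
  have 1: "(\<lambda>x. 1 * u x + 1 * ?w x) = v" by (simp add: fun_eq_iff)
  have 2: "(\<lambda>x. 1 * u x + (1/2) * ?w x) = (\<lambda>x. 1/2 * u x + 1/2 * v x)"
    by (simp add: fun_eq_iff field_simps)
  have "penalised_energy M \<E> \<beta> f v = penalised_energy M \<E> \<beta> f u
    + 2 * 1 * (\<E> u ?w + \<beta> * L2_inner M (\<lambda>x. u x - f x) ?w)
    + 1\<^sup>2 * (\<E> ?w ?w + \<beta> * (L2_norm M ?w)\<^sup>2)"
    using penalised_energy_lincomb[OF form f u w, of \<beta> 1] unfolding 1 .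
  moreover have "penalised_energy M \<E> \<beta> f (\<lambda>x. 1/2 * u x + 1/2 * v x) = penalised_energy M \<E> \<beta> f u
    + 2 * (1/2) * (\<E> u ?w + \<beta> * L2_inner M (\<lambda>x. u x - f x) ?w)
    + (1/2)\<^sup>2 * (\<E> ?w ?w + \<beta> * (L2_norm M ?w)\<^sup>2)"
    using penalised_energy_lincomb[OF form f u w, of \<beta> "1/2"] unfolding 2 .
  ultimately show ?thesis unfolding wE wN by (simp add: power2_eq_square field_simps)
qed

text \<open>Direct method: a minimising sequence is Cauchy in the form norm, closedness gives its
  limit \<open>v\<close>, and the approximate Euler-Lagrange equations along the sequence pass to
  the limit.\<close>

lemma resolvent_exists:
  assumes form: "symmetric_form M \<F> \<E>" and closed: "closed_form M \<F> \<E>"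
    and f: "f \<in> L2_space M" and \<beta>: "1 \<le> \<beta>"
  obtains v where "v \<in> \<F>" "\<And>w. w \<in> \<F> \<Longrightarrow> \<E> v w + \<beta> * L2_inner M (\<lambda>x. v x - f x) w = 0"
proof -
  note D = symmetric_formD[OF form]
  let ?J = "penalised_energy M \<E> \<beta> f"
  define m where "m = (INF u\<in>\<F>. ?J u)"
  have J_nonneg: "0 \<le> ?J u" if "u \<in> \<F>" for u
    using D(5)[OF that] \<beta> by (simp add: penalised_energy_def)
  have bdd: "bdd_below (?J ` \<F>)" using J_nonneg by (intro bdd_belowI[of _ 0]) auto
  have ne: "\<F> \<noteq> {}" using form by (auto simp: symmetric_form_def)
  have m_le: "m \<le> ?J u" if "u \<in> \<F>" for u
    unfolding m_def using bdd that by (rule cINF_lower)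
  have "\<exists>u\<in>\<F>. ?J u < m + 1 / real (Suc n)" for n
    using ne bdd cINF_less_iff[of \<F> ?J "m + 1 / real (Suc n)"] by (auto simp: m_def)
  then obtain u where u: "\<And>n. u n \<in> \<F>" and Ju: "\<And>n. ?J (u n) < m + 1 / real (Suc n)"
    by metis
  \<comment> \<open>The energies of \<open>u i\<close> and \<open>u j\<close> exceed
    \<open>m\<close> by less than \<open>1 / Suc i\<close> and \<open>1 / Suc j\<close>, while their
    midpoint lies in \<open>\<F>\<close> and has energy at least \<open>m\<close>. Since
    \<open>1 \<le> \<beta>\<close>, the quadratic form in the parallelogram identity dominates
    \<open>form_norm_sq\<close>.\<close>
  have Cauchy: "form_norm_sq M \<E> (\<lambda>x. u i x - u j x) \<le> 2 / real (Suc i) + 2 / real (Suc j)" for i j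
  proof -
    have "form_norm_sq M \<E> (\<lambda>x. u i x - u j x)
        \<le> \<E> (\<lambda>x. u i x - u j x) (\<lambda>x. u i x - u j x) + \<beta> * (L2_norm M (\<lambda>x. u i x - u j x))\<^sup>2"
      using mult_right_mono[OF \<beta>, of "(L2_norm M (\<lambda>x. u i x - u j x))\<^sup>2"]
      by (simp add: form_norm_sq_def)
    also have "\<dots> \<le> 2 * ?J (u i) + 2 * ?J (u j) - 4 * m"
      unfolding penalised_energy_parallelogram[OF form f u u]
      using m_le[OF D(2)[OF u[of i] u[of j], of "1/2" "1/2"]] by linarith
    also have "\<dots> \<le> 2 / real (Suc i) + 2 / real (Suc j)"
      using Ju[of i] Ju[of j] by simp
    finally show ?thesis .
  qed
  have "\<exists>N. \<forall>i\<ge>N. \<forall>j\<ge>N. form_norm_sq M \<E> (\<lambda>x. u i x - u j x) < e" if "e > 0" for e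
  proof -
    from that obtain N where N: "1 / real (Suc N) < e / 4"
      using reals_Archimedean[of "e / 4"] by (auto simp: inverse_eq_divide)
    have "form_norm_sq M \<E> (\<lambda>x. u i x - u j x) < e" if "i \<ge> N" "j \<ge> N" for i j
    proof -
      have "1 / real (Suc i) \<le> 1 / real (Suc N)" "1 / real (Suc j) \<le> 1 / real (Suc N)"
        using that by (auto intro!: divide_left_mono)
      with Cauchy[of i j] N show ?thesis by simp
    qed
    then show ?thesis by blast
  qed
  with closed u obtain v where v: "v \<in> \<F>"
    and lim: "(\<lambda>n. form_norm_sq M \<E> (\<lambda>x. u n x - v x)) \<longlonglongrightarrow> 0"
    unfolding closed_form_def by blast
  have d: "(\<lambda>x. u n x - v x) \<in> \<F>" for n using D(2)[OF u[of n] v, of 1 "-1"] by simp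
  \<comment> \<open>\<open>A n\<close> is half the derivative of the functional at \<open>u n\<close> in direction \<open>w\<close>; it is small because
    \<open>u n\<close> is an almost minimiser\<close>
  have "\<E> v w + \<beta> * L2_inner M (\<lambda>x. v x - f x) w = 0" if w: "w \<in> \<F>" for w
  proof -
    define A where "A n = \<E> (u n) w + \<beta> * L2_inner M (\<lambda>x. u n x - f x) w" for n
    define Q where "Q = \<E> w w + \<beta> * (L2_norm M w)\<^sup>2"
    have "0 \<le> Q" using D(5)[OF w] \<beta> by (simp add: Q_def)
    \<comment> \<open>Moving from \<open>u n\<close> to \<open>u n + s * w\<close> lowers the
      functional by at most \<open>1 / Suc n\<close>, whatever \<open>s\<close> is. The resulting
      quadratic in \<open>s\<close> is non-negative, and its discriminant controls
      \<open>A n\<close>.\<close>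
    have "(A n)\<^sup>2 \<le> 1 / real (Suc n) * Q" for n
    proof (rule nonneg_quadratic_imp_discriminant_le[OF _ \<open>0 \<le> Q\<close>])
      fix s
      have "m \<le> ?J (\<lambda>x. 1 * u n x + s * w x)" using u w by (intro m_le D(2))
      with Ju[of n] show "0 \<le> 1 / real (Suc n) + 2 * s * A n + s\<^sup>2 * Q"
        unfolding penalised_energy_lincomb[OF form f u w] A_def Q_def by linarith
    qed
    moreover have "(\<lambda>n. 1 / real (Suc n) * Q) \<longlonglongrightarrow> 0"
      using tendsto_mult_right[OF LIMSEQ_Suc[OF lim_1_over_n], of Q] by simp
    ultimately have A0: "A \<longlonglongrightarrow> 0" by (rule tendsto_0_if_square_le)
    have wL2: "w \<in> L2_space M" and vL2: "v \<in> L2_space M" and uL2: "u n \<in> L2_space M" for n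
      using D(1) u v w by auto
    have dL2: "(\<lambda>x. u n x - v x) \<in> L2_space M" for n using D(1) d by auto
    \<comment> \<open>Energy and squared norm are each at most \<open>form_norm_sq\<close>, so form
      convergence of \<open>u n\<close> to \<open>v\<close> makes both pairings with
      \<open>w\<close> converge, by the two Cauchy-Schwarz inequalities.\<close>
    have sq1: "(\<E> (\<lambda>x. u n x - v x) w)\<^sup>2 \<le> form_norm_sq M \<E> (\<lambda>x. u n x - v x) * \<E> w w" for n
      using symmetric_form_Cauchy_Schwarz[OF form d[of n] w]
        mult_right_mono[of "\<E> (\<lambda>x. u n x - v x) (\<lambda>x. u n x - v x)"
          "form_norm_sq M \<E> (\<lambda>x. u n x - v x)" "\<E> w w"] D(5)[OF w]
      by (simp add: form_norm_sq_def)
    have sq2: "(L2_inner M (\<lambda>x. u n x - v x) w)\<^sup>2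
        \<le> form_norm_sq M \<E> (\<lambda>x. u n x - v x) * (L2_norm M w)\<^sup>2" for n
    proof -
      have "(L2_inner M (\<lambda>x. u n x - v x) w)\<^sup>2 \<le> (L2_norm M (\<lambda>x. u n x - v x) * L2_norm M w)\<^sup>2"
        using power_mono[OF L2_inner_Cauchy_Schwarz[OF dL2[of n] wL2], of 2] by simp
      also have "\<dots> \<le> form_norm_sq M \<E> (\<lambda>x. u n x - v x) * (L2_norm M w)\<^sup>2"
        using D(5)[OF d[of n]]
        by (auto simp: power_mult_distrib form_norm_sq_def intro!: mult_right_mono)
      finally show ?thesis .
    qed
    have null: "(\<lambda>n. form_norm_sq M \<E> (\<lambda>x. u n x - v x) * c) \<longlonglongrightarrow> 0" for c
      using tendsto_mult_right[OF lim, of c] by simp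
    have l1: "(\<lambda>n. \<E> (\<lambda>x. u n x - v x) w) \<longlonglongrightarrow> 0"
      using sq1 null by (rule tendsto_0_if_square_le)
    have l2: "(\<lambda>n. L2_inner M (\<lambda>x. u n x - v x) w) \<longlonglongrightarrow> 0"
      using sq2 null by (rule tendsto_0_if_square_le)
    \<comment> \<open>The left side does not depend on \<open>n\<close>, while each term on the
      right tends to 0.\<close>
    have "\<E> v w + \<beta> * L2_inner M (\<lambda>x. v x - f x) w
        = A n - \<E> (\<lambda>x. u n x - v x) w - \<beta> * L2_inner M (\<lambda>x. u n x - v x) w" for n
      using D(3)[OF u[of n] v w, of 1 "-1"] uL2 vL2 wL2 f
      by (simp add: A_def L2_inner_diff_left algebra_simps)
    moreover have "(\<lambda>n. A n - \<E> (\<lambda>x. u n x - v x) w - \<beta> * L2_inner M (\<lambda>x. u n x - v x) w)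
        \<longlonglongrightarrow> 0 - 0 - \<beta> * 0"
      by (intro tendsto_intros A0 l1 l2)
    ultimately have "(\<lambda>n::nat. \<E> v w + \<beta> * L2_inner M (\<lambda>x. v x - f x) w) \<longlonglongrightarrow> 0" by simp
    then show ?thesis by (simp add: LIMSEQ_const_iff)
  qed
  with v that show ?thesis by blast
qed

text \<open>Take \<open>v\<close> in \<open>\<F>\<close> close to \<open>f\<close> and compare the
  penalised energies of \<open>v\<close> and of the resolvent \<open>u\<close>: for large
  \<open>\<beta>\<close> the penalty forces \<open>u\<close> to be close to \<open>f\<close>
  too.\<close>

lemma form_generator_dense:
  assumes form: "symmetric_form M \<F> \<E>" and closed: "closed_form M \<F> \<E>"
    and dense: "densely_defined M \<F>" and f: "f \<in> L2_space M" and e: "e > 0"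
  obtains u h where "form_generator M \<F> \<E> u h" "L2_norm M (\<lambda>x. u x - f x) < e"
proof -
  note D = symmetric_formD[OF form]
  have "e / 2 > 0" using e by simp
  then obtain v where v: "v \<in> \<F>" and "L2_norm M (\<lambda>x. f x - v x) < e / 2"
    using dense f unfolding densely_defined_def by blast
  then have "L2_norm M (\<lambda>x. v x - f x) < e / 2" using L2_norm_minus_commute[of M f v] by simp
  then have v_near: "(L2_norm M (\<lambda>x. v x - f x))\<^sup>2 \<le> (e / 2)\<^sup>2"
    by (intro power_mono) (auto simp: L2_norm_nonneg)
  \<comment> \<open>Chosen so that \<open>\<E> v v\<close> is at most
    \<open>\<beta> * (e / 2)\<^sup>2\<close>; the summand 1 ensures
    \<open>1 \<le> \<beta>\<close>.\<close>
  define \<beta> where "\<beta> = 1 + \<E> v v / (e / 2)\<^sup>2"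
  have \<beta>: "1 \<le> \<beta>" using D(5)[OF v] by (simp add: \<beta>_def)
  obtain u where u: "u \<in> \<F>"
    and Eu: "\<And>w. w \<in> \<F> \<Longrightarrow> \<E> u w + \<beta> * L2_inner M (\<lambda>x. u x - f x) w = 0"
    using resolvent_exists[OF form closed f \<beta>] by blast
  have uL2: "u \<in> L2_space M" and dL2: "(\<lambda>x. u x - f x) \<in> L2_space M"
    using D(1)[OF u] f by (auto intro: L2_space_diff)
  \<comment> \<open>The resolvent equation says that \<open>L u = \<beta> * (u - f)\<close>.\<close>
  have "form_generator M \<F> \<E> u (\<lambda>x. \<beta> * u x + (- \<beta>) * f x)"
    unfolding form_generator_def
  proof (intro conjI ballI)
    fix g assume g: "g \<in> \<F>"
    show "\<E> u g = - L2_inner M (\<lambda>x. \<beta> * u x + (- \<beta>) * f x) g"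
      using Eu[OF g] uL2 f D(1)[OF g]
      by (simp only: L2_inner_lincomb_left L2_inner_diff_left) (simp add: algebra_simps)
  qed (rule u L2_space_lincomb[OF uL2 f])+
  moreover have "L2_norm M (\<lambda>x. u x - f x) < e"
  proof -
    let ?w = "\<lambda>x. 1 * v x + (-1) * u x"
    have w: "?w \<in> \<F>" using v u by (rule D(2))
    have "(\<lambda>x. 1 * u x + 1 * ?w x) = v" by (simp add: fun_eq_iff)
    \<comment> \<open>The first variation at \<open>u\<close> vanishes, so only the non-negative
      quadratic term separates the two energies: the critical point \<open>u\<close> is a
      minimiser.\<close>
    then have "penalised_energy M \<E> \<beta> f v
        = penalised_energy M \<E> \<beta> f u + (\<E> ?w ?w + \<beta> * (L2_norm M ?w)\<^sup>2)"
      using penalised_energy_lincomb[OF form f u w, of \<beta> 1] Eu[OF w] by simp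
    then have "penalised_energy M \<E> \<beta> f u \<le> penalised_energy M \<E> \<beta> f v"
      using D(5)[OF w] \<beta> by simp
    then have "\<beta> * (L2_norm M (\<lambda>x. u x - f x))\<^sup>2 \<le> \<E> v v + \<beta> * (L2_norm M (\<lambda>x. v x - f x))\<^sup>2"
      using D(5)[OF u] by (simp add: penalised_energy_def)
    also have "\<dots> \<le> \<beta> * (e / 2)\<^sup>2 + \<beta> * (e / 2)\<^sup>2"
    proof (rule add_mono)
      show "\<E> v v \<le> \<beta> * (e / 2)\<^sup>2" using e by (simp add: \<beta>_def distrib_right)
      show "\<beta> * (L2_norm M (\<lambda>x. v x - f x))\<^sup>2 \<le> \<beta> * (e / 2)\<^sup>2"
        using \<beta> v_near by (intro mult_left_mono) auto
    qed
    also have "\<dots> = \<beta> * (e\<^sup>2 / 2)" by (simp add: power2_eq_square)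
    finally have "(L2_norm M (\<lambda>x. u x - f x))\<^sup>2 \<le> e\<^sup>2 / 2" using \<beta> by simp
    also have "\<dots> < e\<^sup>2" using e by simp
    finally show ?thesis using e by (simp add: power_less_imp_less_base)
  qed
  ultimately show ?thesis using that by blast
qed

subsection \<open>Exponential decay of the variance along the semigroup\<close>

lemma selfadjoint_semigroupD:
  assumes "selfadjoint_semigroup M P"
  shows "t \<ge> 0 \<Longrightarrow> f \<in> L2_space M \<Longrightarrow> P t f \<in> L2_space M"
    and "t \<ge> 0 \<Longrightarrow> f \<in> L2_space M \<Longrightarrow> g \<in> L2_space M \<Longrightarrow> AE x in M. f x = g x \<Longrightarrow>
      AE x in M. P t f x = P t g x"
    and "t \<ge> 0 \<Longrightarrow> f \<in> L2_space M \<Longrightarrow> g \<in> L2_space M \<Longrightarrow>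
      AE x in M. P t (\<lambda>y. a * f y + b * g y) x = a * P t f x + b * P t g x"
    and "t \<ge> 0 \<Longrightarrow> f \<in> L2_space M \<Longrightarrow> L2_norm M (P t f) \<le> L2_norm M f"
    and "t \<ge> 0 \<Longrightarrow> f \<in> L2_space M \<Longrightarrow> g \<in> L2_space M \<Longrightarrow>
      L2_inner M (P t f) g = L2_inner M f (P t g)"
    and "f \<in> L2_space M \<Longrightarrow> AE x in M. P 0 f x = f x"
    and "s \<ge> 0 \<Longrightarrow> t \<ge> 0 \<Longrightarrow> f \<in> L2_space M \<Longrightarrow> AE x in M. P (s + t) f x = P s (P t f) x"
    and "f \<in> L2_space M \<Longrightarrow> ((\<lambda>t. L2_norm M (\<lambda>x. P t f x - f x)) \<longlongrightarrow> 0) (at_right 0)"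
  using assms[unfolded selfadjoint_semigroup_def] by (elim conjE; simp; fail)+

lemma semigroup_norm_diff_le:
  assumes P: "selfadjoint_semigroup M P" and t: "t \<ge> 0"
    and f: "f \<in> L2_space M" and g: "g \<in> L2_space M"
  shows "L2_norm M (\<lambda>x. P t f x - P t g x) \<le> L2_norm M (\<lambda>x. f x - g x)"
proof -
  note S = selfadjoint_semigroupD[OF P]
  have d: "(\<lambda>x. f x - g x) \<in> L2_space M" using f g by (rule L2_space_diff)
  have "AE x in M. P t f x - P t g x = P t (\<lambda>x. f x - g x) x"
    using S(3)[OF t f g, of 1 "-1"] by (simp add: eq_commute)
  then have "L2_norm M (\<lambda>x. P t f x - P t g x) = L2_norm M (P t (\<lambda>x. f x - g x))"
    using t f g d by (intro L2_norm_cong_AE) (auto intro: L2_space_diff S(1))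
  also have "\<dots> \<le> L2_norm M (\<lambda>x. f x - g x)" using t d by (rule S(4))
  finally show ?thesis .
qed

text \<open>Symmetry moves part of the time to the other factor. With equal halves this turns
  \<open>\<langle>P\<^sub>t f, f\<rangle>\<close> into the squared norm of the orbit at time
  \<open>t / 2\<close>.\<close>

lemma semigroup_inner_add:
  assumes P: "selfadjoint_semigroup M P" and s: "s \<ge> 0" and t: "t \<ge> 0"
    and f: "f \<in> L2_space M" and g: "g \<in> L2_space M"
  shows "L2_inner M (P (s + t) f) g = L2_inner M (P s f) (P t g)"
proof -
  note S = selfadjoint_semigroupD[OF P]
  have "L2_inner M (P (s + t) f) g = L2_inner M (P t (P s f)) g"
    using S(7)[OF t s f] s t f g
    by (intro L2_inner_cong_AE) (auto simp: add.commute intro: S(1))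
  also have "\<dots> = L2_inner M (P s f) (P t g)" using s t f g by (intro S(5) S(1))
  finally show ?thesis .
qed

text \<open>The increment is \<open>P s\<close> applied to \<open>P h f - f\<close>, and
  \<open>P s\<close> contracts; continuity of the orbit at 0 is thus uniform in time.\<close>

lemma semigroup_norm_shift_le:
  assumes P: "selfadjoint_semigroup M P" and s: "s \<ge> 0" and h: "h \<ge> 0" and f: "f \<in> L2_space M"
  shows "L2_norm M (\<lambda>x. P (s + h) f x - P s f x) \<le> L2_norm M (\<lambda>x. P h f x - f x)"
proof -
  note S = selfadjoint_semigroupD[OF P]
  have "AE x in M. P (s + h) f x - P s f x = P s (P h f) x - P s f x"
    using S(7)[OF s h f] by eventually_elim simp
  then have "L2_norm M (\<lambda>x. P (s + h) f x - P s f x) = L2_norm M (\<lambda>x. P s (P h f) x - P s f x)"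
    using s h f by (intro L2_norm_cong_AE) (auto intro!: L2_space_diff S(1))
  also have "\<dots> \<le> L2_norm M (\<lambda>x. P h f x - f x)"
    using s h f by (intro semigroup_norm_diff_le[OF P] S(1))
  finally show ?thesis .
qed

lemma L2_space_difference_quotient:
  assumes "f \<in> L2_space M" "g \<in> L2_space M"
  shows "(\<lambda>x. (f x - g x) / s) \<in> L2_space M"
  using L2_space_lincomb[OF assms, of "1 / s" "- (1 / s)"]
  by (simp add: diff_divide_distrib)

text \<open>The difference quotient of \<open>P t f\<close> is almost everywhere \<open>P t\<close>
  applied to that of \<open>f\<close>, so by contraction its distance from \<open>P t h\<close> is
  no larger than before.\<close>

lemma semigroup_generator_invariant:
  assumes P: "selfadjoint_semigroup M P" and gen: "semigroup_generator M P f h" and t: "t \<ge> 0"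
  shows "semigroup_generator M P (P t f) (P t h)"
proof -
  note S = selfadjoint_semigroupD[OF P]
  have f: "f \<in> L2_space M" and h: "h \<in> L2_space M"
    and lim: "((\<lambda>s. L2_norm M (\<lambda>x. (P s f x - f x) / s - h x)) \<longlongrightarrow> 0) (at_right 0)"
    using gen by (auto simp: semigroup_generator_def)
  have le: "L2_norm M (\<lambda>x. (P s (P t f) x - P t f x) / s - P t h x)
      \<le> L2_norm M (\<lambda>x. (P s f x - f x) / s - h x)" if s: "s > 0" for s
  proof -
    let ?q = "\<lambda>x. (P s f x - f x) / s"
    have Psf: "P s f \<in> L2_space M" using s f by (intro S(1)) auto
    have q: "?q \<in> L2_space M" using Psf f by (rule L2_space_difference_quotient)
    have "?q = (\<lambda>x. (1 / s) * P s f x + (- (1 / s)) * f x)"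
      by (simp add: diff_divide_distrib)
    then have 1: "AE x in M. P t ?q x = (1 / s) * P t (P s f) x + (- (1 / s)) * P t f x"
      using S(3)[OF t Psf f, of "1 / s" "- (1 / s)"] by simp
    \<comment> \<open>\<open>P s\<close> and \<open>P t\<close> commute because both orders of
      composition equal \<open>P (t + s)\<close>.\<close>
    have 2: "AE x in M. P (t + s) f x = P t (P s f) x" using t s f by (intro S(7)) auto
    have 3: "AE x in M. P (t + s) f x = P s (P t f) x"
      using S(7)[of s t f] t s f by (simp add: add.commute)
    have "AE x in M. (P s (P t f) x - P t f x) / s - P t h x = P t ?q x - P t h x"
      using 1 2 3 by eventually_elim (simp add: diff_divide_distrib)
    then have "L2_norm M (\<lambda>x. (P s (P t f) x - P t f x) / s - P t h x)
        = L2_norm M (\<lambda>x. P t ?q x - P t h x)"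
      using s t f h q
      by (intro L2_norm_cong_AE) (auto intro!: L2_space_diff L2_space_difference_quotient S(1))
    also have "\<dots> \<le> L2_norm M (\<lambda>x. ?q x - h x)"
      using t q h by (rule semigroup_norm_diff_le[OF P])
    finally show ?thesis .
  qed
  have "((\<lambda>s. L2_norm M (\<lambda>x. (P s (P t f) x - P t f x) / s - P t h x)) \<longlongrightarrow> 0) (at_right 0)"
    by (rule tendsto_sandwich[OF _ _ tendsto_const lim])
      (auto simp: L2_norm_nonneg eventually_at_filter intro!: always_eventually le)
  then show ?thesis using t f h by (simp add: semigroup_generator_def S(1))
qed

text \<open>By symmetry the difference quotient of the correlation is the pairing of the quotient
  \<open>D s\<close>, which tends to \<open>h\<close>, with a point of the orbit near
  \<open>P t f\<close>. Hence only the one-sided limit defining the generator is needed for a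
  two-sided derivative.\<close>

lemma semigroup_correlation_has_derivative:
  assumes P: "selfadjoint_semigroup M P" and gen: "semigroup_generator M P f h" and t: "t > 0"
  shows "((\<lambda>t. L2_inner M (P t f) f) has_real_derivative L2_inner M h (P t f)) (at t)"
proof -
  note S = selfadjoint_semigroupD[OF P]
  have f: "f \<in> L2_space M" and h: "h \<in> L2_space M"
    and lim: "((\<lambda>s. L2_norm M (\<lambda>x. (P s f x - f x) / s - h x)) \<longlongrightarrow> 0) (at_right 0)"
    using gen by (auto simp: semigroup_generator_def)
  define D where "D s = (\<lambda>x. (P s f x - f x) / s)" for s
  \<comment> \<open>The first term bounds the error of replacing \<open>D s\<close> by
    \<open>h\<close>, the second the error of shifting time by at most \<open>s\<close>.\<close>
  define B where "B s = L2_norm M (\<lambda>x. D s x - h x) * L2_norm M f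
      + L2_norm M h * L2_norm M (\<lambda>x. P s f x - f x)" for s
  have "(B \<longlongrightarrow> 0 * L2_norm M f + L2_norm M h * 0) (at_right 0)"
    unfolding B_def D_def using f by (intro tendsto_intros lim S(8))
  then have B0: "(B \<longlongrightarrow> 0) (at_right 0)" by simp
  have D_L2: "D s \<in> L2_space M" if "s > 0" for s
    unfolding D_def using that f by (intro L2_space_difference_quotient S(1)) auto
  \<comment> \<open>\<open>r\<close> is the left end of the interval between \<open>t\<close> and the second point of the difference
    quotient, so that this covers both one-sided derivatives\<close>
  have near: "\<bar>L2_inner M (D s) (P r f) - L2_inner M h (P t f)\<bar> \<le> B s"
    if s: "s > 0" and r: "r \<ge> 0" and rt: "t = r \<or> t = r + s" for s r
  proof -
    have L2: "P r f \<in> L2_space M" "P t f \<in> L2_space M" using r t f by (auto intro: S(1))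
    have "\<bar>L2_inner M (\<lambda>x. D s x - h x) (P r f)\<bar> \<le> L2_norm M (\<lambda>x. D s x - h x) * L2_norm M (P r f)"
      using D_L2[OF s] h L2 by (intro L2_inner_Cauchy_Schwarz L2_space_diff)
    also have "\<dots> \<le> L2_norm M (\<lambda>x. D s x - h x) * L2_norm M f"
      using r f by (intro mult_left_mono S(4)) (auto simp: L2_norm_nonneg)
    finally have 1: "\<bar>L2_inner M (\<lambda>x. D s x - h x) (P r f)\<bar>
        \<le> L2_norm M (\<lambda>x. D s x - h x) * L2_norm M f" .
    have "\<bar>L2_inner M h (\<lambda>x. P t f x - P r f x)\<bar> \<le> L2_norm M h * L2_norm M (\<lambda>x. P t f x - P r f x)"
      using h L2 by (intro L2_inner_Cauchy_Schwarz L2_space_diff)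
    also have "\<dots> \<le> L2_norm M h * L2_norm M (\<lambda>x. P s f x - f x)"
    proof (rule mult_left_mono)
      show "L2_norm M (\<lambda>x. P t f x - P r f x) \<le> L2_norm M (\<lambda>x. P s f x - f x)"
        using rt
      proof
        assume "t = r"
        then have "L2_norm M (\<lambda>x. P t f x - P r f x) = 0" by (simp add: L2_norm_def)
        then show ?thesis by (simp add: L2_norm_nonneg)
      next
        assume "t = r + s"
        then show ?thesis using semigroup_norm_shift_le[OF P r _ f, of s] s by simp
      qed
    qed (simp add: L2_norm_nonneg)
    finally have 2: "\<bar>L2_inner M h (\<lambda>x. P t f x - P r f x)\<bar>
        \<le> L2_norm M h * L2_norm M (\<lambda>x. P s f x - f x)" .
    have "L2_inner M (D s) (P r f) - L2_inner M h (P t f)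
        = L2_inner M (\<lambda>x. D s x - h x) (P r f) - L2_inner M h (\<lambda>x. P t f x - P r f x)"
      using D_L2[OF s] h L2 by (simp add: L2_inner_diff_left L2_inner_diff_right)
    with 1 2 show ?thesis unfolding B_def by linarith
  qed
  have quot: "(L2_inner M (P (r + s) f) f - L2_inner M (P r f) f) / s = L2_inner M (D s) (P r f)"
    if s: "s > 0" and r: "r \<ge> 0" for s r
  proof -
    have "L2_inner M (P (r + s) f) f = L2_inner M (P s f) (P r f)"
      using semigroup_inner_add[OF P _ r f f, of s] s by (simp add: add.commute)
    moreover have "L2_inner M (P r f) f = L2_inner M f (P r f)" by (rule L2_inner_commute)
    moreover have "L2_inner M (D s) (P r f)
        = (1 / s) * L2_inner M (P s f) (P r f) + (- (1 / s)) * L2_inner M f (P r f)"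
    proof -
      have "D s = (\<lambda>x. (1 / s) * P s f x + (- (1 / s)) * f x)"
        by (simp add: D_def diff_divide_distrib)
      then show ?thesis
        using s r f L2_inner_lincomb_left[of "P s f" M f "P r f" "1 / s" "- (1 / s)"] S(1) by simp
    qed
    ultimately show ?thesis by (simp add: diff_divide_distrib)
  qed
  let ?Q = "\<lambda>y. (L2_inner M (P y f) f - L2_inner M (P t f) f) / (y - t)"
  have bound: "\<bar>?Q y - L2_inner M h (P t f)\<bar> \<le> B \<bar>y - t\<bar>" if y: "y > 0" "y \<noteq> t" for y
  proof (cases "y < t")
    case True
    then have "?Q y = L2_inner M (D \<bar>y - t\<bar>) (P y f)"
      using quot[of "t - y" y] y by (simp add: divide_simps) (simp add: algebra_simps)
    then show ?thesis using near[of "t - y" y] True y by simp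
  next
    case False
    then have "?Q y = L2_inner M (D \<bar>y - t\<bar>) (P t f)"
      using quot[of "y - t" t] y t by simp
    then show ?thesis using near[of "y - t" t] False y t by simp
  qed
  \<comment> \<open>The error bound depends only on the distance to \<open>t\<close>, which tends to
    0 through positive values from either side.\<close>
  have "filterlim (\<lambda>y. \<bar>y - t\<bar>) (at_right 0) (at t)"
    unfolding filterlim_at
    by (auto intro!: tendsto_eq_intros simp: eventually_at_filter)
  with B0 have "((\<lambda>y. B \<bar>y - t\<bar>) \<longlongrightarrow> 0) (at t)" by (rule filterlim_compose)
  moreover have "\<forall>\<^sub>F y in at t. norm (?Q y - L2_inner M h (P t f)) \<le> B \<bar>y - t\<bar>"
  proof -
    have "\<forall>\<^sub>F y in at t. y > 0"
      using t order_tendstoD(1)[OF tendsto_ident_at, of 0 t UNIV] by simp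
    moreover have "\<forall>\<^sub>F y in at t. y \<noteq> t" by (simp add: eventually_at_filter)
    ultimately show ?thesis by eventually_elim (use bound in simp)
  qed
  ultimately have "((\<lambda>y. ?Q y - L2_inner M h (P t f)) \<longlongrightarrow> 0) (at t)"
    by (rule Lim_null_comparison[rotated])
  then have "(?Q \<longlongrightarrow> L2_inner M h (P t f)) (at t)" by (simp add: LIM_zero_iff)
  then show ?thesis by (simp add: has_field_derivative_iff)
qed

lemma semigroup_correlation_tendsto_at_0:
  assumes P: "selfadjoint_semigroup M P" and f: "f \<in> L2_space M"
  shows "((\<lambda>t. L2_inner M (P t f) f) \<longlongrightarrow> L2_inner M f f) (at_right 0)"
proof -
  note S = selfadjoint_semigroupD[OF P]
  \<comment> \<open>\<open>tendsto_L2_inner\<close> asks for square-integrability at every index,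
    known only for times \<open>t \<ge> 0\<close>; the absolute value ensures it and changes nothing
    to the right of 0.\<close>
  have lim: "((\<lambda>t. L2_norm M (\<lambda>x. P \<bar>t\<bar> f x - f x)) \<longlongrightarrow> 0) (at_right 0)"
    using S(8)[OF f]
    by (rule Lim_transform_eventually) (simp add: eventually_at_filter)
  have "((\<lambda>t. L2_inner M (P \<bar>t\<bar> f) f) \<longlongrightarrow> L2_inner M f f) (at_right 0)"
    using f by (intro tendsto_L2_inner lim S(1)) (auto simp: L2_norm_def)
  then show ?thesis
    by (rule Lim_transform_eventually) (simp add: eventually_at_filter)
qed

section \<open>Conservation of the mean and the Gronwall argument\<close>

text \<open>The mean is the pairing with the constant 1; symmetry moves \<open>P t\<close> onto that
  constant, which conservativeness fixes.\<close>

lemma (in prob_space) semigroup_mean: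
  assumes P: "selfadjoint_semigroup M P" and cons: "conservative M P"
    and t: "t \<ge> 0" and f: "f \<in> L2_space M"
  shows "(\<integral>x. P t f x \<partial>M) = (\<integral>x. f x \<partial>M)"
proof -
  note S = selfadjoint_semigroupD[OF P]
  have one: "(\<lambda>_. 1) \<in> L2_space M" by (rule L2_space_bounded[of _ 1]) auto
  have "(\<integral>x. P t f x \<partial>M) = L2_inner M f (P t (\<lambda>_. 1))"
    using S(5)[OF t f one] by (simp add: L2_inner_def)
  also have "\<dots> = L2_inner M f (\<lambda>_. 1)"
    using cons t f one by (intro L2_inner_cong_AE) (auto simp: conservative_def intro: S(1))
  finally show ?thesis by (simp add: L2_inner_def)
qed

text \<open>The left side is the variance of the orbit at time \<open>t / 2\<close>. Its derivative
  in \<open>t\<close> is minus the energy there, which the spectral gap bounds by \<open>- l\<close>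
  times the same variance.\<close>

lemma (in prob_space) variance_decay_on_domain:
  assumes heat: "heat_semigroup M \<F> \<E> P" and cons: "conservative M P"
    and gap: "spectral_gap M \<F> \<E> l" and gen: "semigroup_generator M P f h" and t: "t \<ge> 0"
  shows "L2_inner M (P t f) f - (\<integral>x. f x \<partial>M)\<^sup>2
    \<le> exp (- l * t) * (L2_inner M f f - (\<integral>x. f x \<partial>M)\<^sup>2)"
proof -
  have P: "selfadjoint_semigroup M P"
    and gen_eq: "\<And>f h. semigroup_generator M P f h \<longleftrightarrow> form_generator M \<F> \<E> f h"
    using heat by (auto simp: heat_semigroup_def)
  note S = selfadjoint_semigroupD[OF P]
  have f: "f \<in> L2_space M" and h: "h \<in> L2_space M"
    using gen by (auto simp: semigroup_generator_def)
  define m where "m = (\<integral>x. f x \<partial>M)"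
  \<comment> \<open>At 0 the right limit is put in directly, so that \<open>g 0\<close> is the
    variance of \<open>f\<close> itself.\<close>
  define g where "g t = (if t = 0 then L2_inner M f f else L2_inner M (P t f) f) - m\<^sup>2" for t
  have g_pos: "g t = L2_inner M (P t f) f - m\<^sup>2" if "t > 0" for t
    using that by (simp add: g_def)
  \<comment> \<open>Half of the time goes to each factor: \<open>\<langle>h, P\<^sub>t f\<rangle> =
    \<langle>P\<^sub>r h, P\<^sub>r f\<rangle> = - \<E> (P\<^sub>r f, P\<^sub>r f)\<close> with
    \<open>r = t / 2\<close>. The gap then applies to \<open>P\<^sub>r f\<close>, whose mean is
    still \<open>m\<close>.\<close>
  have dissipation: "L2_inner M h (P t f) \<le> - l * g t" if t: "t > 0" for t
  proof -
    let ?r = "t / 2"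
    have r: "?r \<ge> 0" using t by simp
    have "form_generator M \<F> \<E> (P ?r f) (P ?r h)"
      using semigroup_generator_invariant[OF P gen r] gen_eq by simp
    then have u: "P ?r f \<in> \<F>" and E: "\<E> (P ?r f) (P ?r f) = - L2_inner M (P ?r h) (P ?r f)"
      by (auto simp: form_generator_def)
    have add: "L2_inner M (P t k) f = L2_inner M (P ?r k) (P ?r f)" if "k \<in> L2_space M" for k
      using semigroup_inner_add[OF P r r that f] by simp
    have "L2_inner M h (P t f) = - \<E> (P ?r f) (P ?r f)"
      using S(5)[of t h f] add[OF h] E t h f by simp
    moreover have "l * ((\<integral>x. (P ?r f x)\<^sup>2 \<partial>M) - (\<integral>x. P ?r f x \<partial>M)\<^sup>2) \<le> \<E> (P ?r f) (P ?r f)"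
    proof -
      have "l > 0" and "(\<integral>x. (P ?r f x)\<^sup>2 \<partial>M) - (\<integral>x. P ?r f x \<partial>M)\<^sup>2 \<le> 1 / l * \<E> (P ?r f) (P ?r f)"
        using gap u unfolding spectral_gap_def by blast+
      then show ?thesis by (simp add: field_simps)
    qed
    moreover have "(\<integral>x. (P ?r f x)\<^sup>2 \<partial>M) = L2_inner M (P t f) f"
      unfolding add[OF f] by (simp add: L2_inner_def power2_eq_square)
    moreover have "(\<integral>x. P ?r f x \<partial>M) = m"
      using semigroup_mean[OF P cons r f] by (simp add: m_def)
    ultimately show ?thesis by (simp add: g_pos t)
  qed
  have deriv: "(g has_real_derivative L2_inner M h (P t f)) (at t)" if t: "t > 0" for t
  proof -
    have "((\<lambda>t. L2_inner M (P t f) f - m\<^sup>2) has_real_derivative L2_inner M h (P t f) - 0) (at t)"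
      by (intro DERIV_diff DERIV_const semigroup_correlation_has_derivative[OF P gen t])
    moreover have "\<forall>\<^sub>F s in nhds t. L2_inner M (P s f) f - m\<^sup>2 = g s"
      using eventually_nhds_in_open[of "{0<..}" t] t
      by (auto elim!: eventually_mono simp: g_pos)
    ultimately show ?thesis
      using DERIV_cong_ev[OF refl, of "\<lambda>t. L2_inner M (P t f) f - m\<^sup>2" g t "L2_inner M h (P t f)"]
      by simp
  qed
  have g0: "(g \<longlongrightarrow> g 0) (at_right 0)"
  proof -
    have "((\<lambda>t. L2_inner M (P t f) f - m\<^sup>2) \<longlongrightarrow> L2_inner M f f - m\<^sup>2) (at_right 0)"
      by (intro tendsto_intros semigroup_correlation_tendsto_at_0[OF P f])
    then have "(g \<longlongrightarrow> L2_inner M f f - m\<^sup>2) (at_right 0)"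
      by (rule Lim_transform_eventually) (simp add: eventually_at_filter g_def)
    then show ?thesis by (simp add: g_def)
  qed
  have "exp (l * t) * g t \<le> g 0"
  proof (cases "t = 0")
    case False
    with t have t: "0 < t" by simp
    \<comment> \<open>With the integrating factor the differential inequality becomes monotonicity.
      The derivative is known only at positive times, so continuity up to 0 is supplied separately
      from \<open>g0\<close>.\<close>
    have "exp (l * t) * g t \<le> exp (l * 0) * g 0"
    proof (rule DERIV_nonpos_imp_decreasing_open[of 0 t "\<lambda>s. exp (l * s) * g s"])
      show "0 \<le> t" using t by simp
      fix s :: real assume s: "0 < s" "s < t"
      have "((\<lambda>s. exp (l * s) * g s) has_real_derivative
          exp (l * s) * l * g s + L2_inner M h (P s f) * exp (l * s)) (at s)"
        using deriv[OF s(1)] by (auto intro!: derivative_eq_intros)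
      moreover have "exp (l * s) * l * g s + L2_inner M h (P s f) * exp (l * s) \<le> 0"
        using mult_right_mono[OF dissipation[OF s(1)], of "exp (l * s)"] by (simp add: algebra_simps)
      ultimately show "\<exists>y. ((\<lambda>s. exp (l * s) * g s) has_real_derivative y) (at s) \<and> y \<le> 0" by blast
    next
      have "continuous_on {0..t} g"
        unfolding continuous_on_def
      proof
        fix s assume "s \<in> {0..t}"
        then consider "s = 0" | "s > 0" by fastforce
        then show "(g \<longlongrightarrow> g s) (at s within {0..t})"
        proof cases
          case 1
          have "at (0::real) within {0..t} = at_right 0"
            using t by (rule at_within_Icc_at_right)
          with 1 g0 show ?thesis by simp
        next
          case 2
          then show ?thesis
            using DERIV_isCont[OF deriv] by (auto simp: isCont_def intro: tendsto_within_subset)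
        qed
      qed
      then show "continuous_on {0..t} (\<lambda>s. exp (l * s) * g s)"
        by (intro continuous_intros)
    qed
    then show ?thesis by simp
  qed simp
  then have "exp (- l * t) * (exp (l * t) * g t) \<le> exp (- l * t) * g 0"
    by (intro mult_left_mono) auto
  moreover have "exp (- l * t) * (exp (l * t) * g t) = g t"
    by (simp add: mult.assoc[symmetric] exp_add[symmetric])
  moreover have "g t = L2_inner M (P t f) f - m\<^sup>2"
  proof (cases "t = 0")
    case True
    have "L2_inner M (P 0 f) f = L2_inner M f f"
      using f S(6)[OF f] by (intro L2_inner_cong_AE) (auto intro: S(1))
    with True show ?thesis by (simp add: g_def)
  qed (simp add: g_def)
  ultimately show ?thesis by (simp only: g_def m_def) simp
qed

text \<open>Both sides are continuous in \<open>f\<close> for the norm of \<open>L\<^sup>2\<close>,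
  so the inequality extends from the dense domain of the generator.\<close>

lemma (in prob_space) variance_decay:
  assumes form: "symmetric_form M \<F> \<E>" "closed_form M \<F> \<E>" "densely_defined M \<F>"
    and heat: "heat_semigroup M \<F> \<E> P" and cons: "conservative M P"
    and gap: "spectral_gap M \<F> \<E> l" and t: "t \<ge> 0" and f: "f \<in> L2_space M"
  shows "L2_inner M (P t f) f - (\<integral>x. f x \<partial>M)\<^sup>2
    \<le> exp (- l * t) * (L2_inner M f f - (\<integral>x. f x \<partial>M)\<^sup>2)"
proof -
  have P: "selfadjoint_semigroup M P"
    and gen_eq: "\<And>f h. semigroup_generator M P f h \<longleftrightarrow> form_generator M \<F> \<E> f h"
    using heat by (auto simp: heat_semigroup_def)
  note S = selfadjoint_semigroupD[OF P]
  have "\<exists>u h. form_generator M \<F> \<E> u h \<and> L2_norm M (\<lambda>x. u x - f x) < 1 / real (Suc n)" for n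
    by (rule form_generator_dense[OF form f, of "1 / real (Suc n)"]) auto
  then obtain u h where gen: "\<And>n. form_generator M \<F> \<E> (u n) (h n)"
    and near: "\<And>n. L2_norm M (\<lambda>x. u n x - f x) < 1 / real (Suc n)"
    by metis
  have u: "u n \<in> L2_space M" for n
    using gen[of n] gen_eq by (auto simp: semigroup_generator_def)
  have one: "(\<lambda>_. 1) \<in> L2_space M" by (rule L2_space_bounded[of _ 1]) auto
  have lim: "(\<lambda>n. L2_norm M (\<lambda>x. u n x - f x)) \<longlonglongrightarrow> 0"
    using near less_imp_le
    by (intro tendsto_sandwich[OF _ _ tendsto_const LIMSEQ_Suc[OF lim_1_over_n]] always_eventually)
      (auto simp: L2_norm_nonneg)
  have Plim: "(\<lambda>n. L2_norm M (\<lambda>x. P t (u n) x - P t f x)) \<longlonglongrightarrow> 0"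
    using semigroup_norm_diff_le[OF P t u f]
    by (intro tendsto_sandwich[OF _ _ tendsto_const lim] always_eventually)
      (auto simp: L2_norm_nonneg)
  have const: "(\<lambda>n::nat. L2_norm M (\<lambda>x. k x - k x)) \<longlonglongrightarrow> 0" for k
    by (simp add: L2_norm_def)
  \<comment> \<open>The mean is the pairing with 1, which is square-integrable on a probability
    space; \<open>const\<close> covers the fixed second factor.\<close>
  have mean: "(\<lambda>n. \<integral>x. u n x \<partial>M) \<longlonglongrightarrow> (\<integral>x. f x \<partial>M)"
    using tendsto_L2_inner[OF u f one one lim const] by (simp add: L2_inner_def)
  have corr: "(\<lambda>n. L2_inner M (P t (u n)) (u n)) \<longlonglongrightarrow> L2_inner M (P t f) f"
    using t u f by (intro tendsto_L2_inner Plim lim S(1))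
  have sq: "(\<lambda>n. L2_inner M (u n) (u n)) \<longlonglongrightarrow> L2_inner M f f"
    using u f by (intro tendsto_L2_inner lim)
  show ?thesis
  proof (rule LIMSEQ_le)
    show "(\<lambda>n. L2_inner M (P t (u n)) (u n) - (\<integral>x. u n x \<partial>M)\<^sup>2)
        \<longlonglongrightarrow> L2_inner M (P t f) f - (\<integral>x. f x \<partial>M)\<^sup>2"
      by (intro tendsto_intros corr mean)
    show "(\<lambda>n. exp (- l * t) * (L2_inner M (u n) (u n) - (\<integral>x. u n x \<partial>M)\<^sup>2))
        \<longlonglongrightarrow> exp (- l * t) * (L2_inner M f f - (\<integral>x. f x \<partial>M)\<^sup>2)"
      by (intro tendsto_intros sq mean)
    show "\<exists>N. \<forall>n\<ge>N. L2_inner M (P t (u n)) (u n) - (\<integral>x. u n x \<partial>M)\<^sup>2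
        \<le> exp (- l * t) * (L2_inner M (u n) (u n) - (\<integral>x. u n x \<partial>M)\<^sup>2)"
      using variance_decay_on_domain[OF heat cons gap _ t] gen gen_eq by blast
  qed
qed

subsection \<open>The heat flow across the boundary of a set\<close>

text \<open>With \<open>q\<close> the mass that the kernel at \<open>y\<close> gives to
  \<open>A\<close>, the inner integral is \<open>1 - q\<close> on \<open>A\<close> and
  \<open>q\<close> off \<open>A\<close>. Both cases are the single expression \<open>?g\<close>,
  whose integral follows from conservation of the mean.\<close>

lemma (in prob_space) nn_integral_kernel_indicator:
  assumes P: "selfadjoint_semigroup M P" and cons: "conservative M P"
    and ker: "heat_kernel M P p" and t: "t \<ge> 0" and A: "A \<in> sets M"
  shows "(\<integral>\<^sup>+ y. (\<integral>\<^sup>+ x. ennreal \<bar>indicator A x - indicator A y :: real\<bar> \<partial>(p t y)) \<partial>M)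
    = ennreal (2 * (measure M A - L2_inner M (P t (indicator A)) (indicator A)))"
proof -
  note S = selfadjoint_semigroupD[OF P]
  let ?f = "indicator A :: 'a \<Rightarrow> real"
  have f_meas: "?f \<in> borel_measurable M" using A by simp
  have f: "?f \<in> L2_space M" using f_meas by (rule L2_space_bounded[of _ 1]) (simp add: indicator_def)
  have one: "(\<lambda>_. 1) \<in> L2_space M" by (rule L2_space_bounded[of _ 1]) auto
  have Pf: "P t ?f \<in> L2_space M" using t f by (rule S(1))
  let ?g = "\<lambda>y. ?f y + P t ?f y - 2 * (P t ?f y * ?f y)"
  have kernel: "p t \<in> measurable M (prob_algebra M)"
    using ker t by (auto simp: heat_kernel_def)
  \<comment> \<open>A free \<open>q\<close> allows the later substitution of
    \<open>P t ?f y\<close>, which agrees with the kernel integral only almost everywhere.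
    Non-negativity is recorded because \<open>ennreal\<close> truncates negative values to
    0.\<close>
  have inner: "(\<integral>\<^sup>+ x. ennreal \<bar>?f x - ?f y\<bar> \<partial>(p t y)) = ennreal (?f y + q - 2 * (q * ?f y))
      \<and> 0 \<le> ?f y + q - 2 * (q * ?f y)"
    if y: "y \<in> space M" and q: "q = (\<integral>x. ?f x \<partial>(p t y))" for y q
  proof -
    have "p t y \<in> space (prob_algebra M)" using kernel y by (rule measurable_space)
    then interpret K: prob_space "p t y" by (simp add: space_prob_algebra)
    have sets: "sets (p t y) = sets M"
      using \<open>p t y \<in> space (prob_algebra M)\<close> by (simp add: space_prob_algebra)
    have A': "A \<in> sets (p t y)" using A sets by simp
    have qA: "q = K.prob A" unfolding q using A' by simp
    show ?thesis
    proof (cases "y \<in> A")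
      case True
      have "(\<integral>\<^sup>+ x. ennreal \<bar>?f x - ?f y\<bar> \<partial>(p t y))
          = (\<integral>\<^sup>+ x. indicator (space (p t y) - A) x \<partial>(p t y))"
        using True by (intro nn_integral_cong) (auto simp: indicator_def)
      also have "\<dots> = ennreal (1 - q)"
        using A' by (simp add: K.emeasure_eq_measure K.prob_compl qA)
      finally show ?thesis using True K.prob_le_1[of A] by (simp add: qA)
    next
      case False
      have "(\<integral>\<^sup>+ x. ennreal \<bar>?f x - ?f y\<bar> \<partial>(p t y)) = (\<integral>\<^sup>+ x. indicator A x \<partial>(p t y))"
        using False by (intro nn_integral_cong) (auto simp: indicator_def)
      also have "\<dots> = ennreal q"
        using A' by (simp add: K.emeasure_eq_measure qA)
      finally show ?thesis using False by (simp add: qA)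
    qed
  qed
  have "\<exists>B. \<forall>x\<in>space M. \<bar>?f x\<bar> \<le> B" by (intro exI[of _ 1]) (simp add: indicator_def)
  then have "AE y in M. P t ?f y = (\<integral>x. ?f x \<partial>(p t y))"
    using ker t f_meas unfolding heat_kernel_def by blast
  then have AE: "AE y in M. (\<integral>\<^sup>+ x. ennreal \<bar>?f x - ?f y\<bar> \<partial>(p t y)) = ennreal (?g y) \<and> 0 \<le> ?g y"
    using AE_space by eventually_elim (rule inner)
  have int: "integrable M ?f" "integrable M (P t ?f)" "integrable M (\<lambda>y. P t ?f y * ?f y)"
    using L2_space_integrable_mult[OF f one] L2_space_integrable_mult[OF Pf one]
      L2_space_integrable_mult[OF Pf f] by simp_all
  have "(\<integral>\<^sup>+ y. (\<integral>\<^sup>+ x. ennreal \<bar>?f x - ?f y\<bar> \<partial>(p t y)) \<partial>M) = (\<integral>\<^sup>+ y. ennreal (?g y) \<partial>M)"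
    using AE by (intro nn_integral_cong_AE) auto
  also have "\<dots> = ennreal (\<integral>y. ?g y \<partial>M)"
    using AE int by (intro nn_integral_eq_integral) auto
  also have "(\<integral>y. ?g y \<partial>M) = measure M A + (\<integral>y. P t ?f y \<partial>M) - 2 * L2_inner M (P t ?f) ?f"
    using int A by (simp add: L2_inner_def)
  also have "(\<integral>y. P t ?f y \<partial>M) = measure M A"
    using semigroup_mean[OF P cons t f] A by simp
  finally show ?thesis by simp
qed

section \<open>From the flow across the boundary to the Cheeger constant\<close>

theorem theorem7p1:
  fixes M :: "'a measure"
    and \<F> :: "('a \<Rightarrow> real) set"
    and \<E> :: "('a \<Rightarrow> real) \<Rightarrow> ('a \<Rightarrow> real) \<Rightarrow> real"
    and P :: "real \<Rightarrow> ('a \<Rightarrow> real) \<Rightarrow> 'a \<Rightarrow> real"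
    and p :: "real \<Rightarrow> 'a \<Rightarrow> 'a measure"
    and lambda1 \<alpha> :: real
  assumes "Dirichlet_space M \<F> \<E>"
    and "emeasure M (space M) = 1"
    and "heat_semigroup M \<F> \<E> P"
    and "conservative M P"
    and "heat_kernel M P p"
    and "spectral_gap M \<F> \<E> lambda1"
    and "0 < \<alpha>" and "\<alpha> \<le> 1"
  shows "Cheeger_constant M p \<alpha> \<ge> ennreal ((1 - exp (- 1)) * lambda1 powr \<alpha>)"
proof -
  interpret prob_space M using assms(2) by (rule prob_spaceI)
  have form: "symmetric_form M \<F> \<E>" "closed_form M \<F> \<E>" "densely_defined M \<F>"
    using assms(1) by (auto simp: Dirichlet_space_def Dirichlet_form_def)
  have P: "selfadjoint_semigroup M P" using assms(3) by (simp add: heat_semigroup_def)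
  have l: "lambda1 > 0" using assms(6) by (simp add: spectral_gap_def)
  \<comment> \<open>At this time the decay factor is \<open>exp (- 1)\<close> and the weight
    \<open>?t powr (- \<alpha>)\<close> is \<open>lambda1 powr \<alpha>\<close>.\<close>
  let ?t = "1 / lambda1"
  have t: "?t > 0" using l by simp
  show ?thesis
    unfolding Cheeger_constant_def
  proof (rule INF_greatest)
    fix A assume "A \<in> {A \<in> sets M. 0 < emeasure M A \<and> emeasure M A \<le> ennreal (1 / 2) \<and>
      (indicator A :: 'a \<Rightarrow> real) \<in> Besov_space M p \<alpha>}"
    then have A: "A \<in> sets M" and "0 < emeasure M A" "emeasure M A \<le> ennreal (1 / 2)" by auto
    then have pos: "0 < prob A" and half: "prob A \<le> 1 / 2"
      using ennreal_le_iff[of "1 / 2" "prob A"]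
      by (simp_all only: emeasure_eq_measure ennreal_less_zero_iff)
    let ?f = "indicator A :: 'a \<Rightarrow> real"
    have f: "?f \<in> L2_space M"
      by (rule L2_space_bounded[of _ 1]) (use A in \<open>auto simp: indicator_def\<close>)
    have f_sq: "L2_inner M ?f ?f = prob A"
      using A by (simp add: L2_inner_def flip: indicator_inter_arith)
    have "L2_inner M (P ?t ?f) ?f - (prob A)\<^sup>2 \<le> exp (- 1) * (prob A - (prob A)\<^sup>2)"
      using variance_decay[OF form assms(3,4,6) less_imp_le[OF t] f] A l by (simp add: f_sq)
    then have "(1 - exp (- 1)) * (2 * (prob A - (prob A)\<^sup>2))
        \<le> 2 * (prob A - L2_inner M (P ?t ?f) ?f)"
      by (simp add: algebra_simps)
    \<comment> \<open>Measure at most 1/2 gives \<open>(prob A)\<^sup>2 \<le> prob A / 2\<close>, so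
      the factor 2 from the two directions of flow compensates for subtracting the squared
      mean.\<close>
    moreover have "(1 - exp (- 1)) * prob A \<le> (1 - exp (- 1)) * (2 * (prob A - (prob A)\<^sup>2))"
      using mult_left_mono[OF half, of "prob A"] pos
      by (intro mult_left_mono) (auto simp: power2_eq_square)
    ultimately have flow: "(1 - exp (- 1)) * prob A \<le> 2 * (prob A - L2_inner M (P ?t ?f) ?f)"
      by linarith
    have powr: "?t powr (- \<alpha>) = lambda1 powr \<alpha>"
      using l by (simp add: powr_divide powr_minus_divide)
    have "ennreal ((1 - exp (- 1)) * lambda1 powr \<alpha>) * emeasure M A
        = ennreal (lambda1 powr \<alpha> * ((1 - exp (- 1)) * prob A))"
      by (simp add: emeasure_eq_measure ennreal_mult[symmetric] mult_ac)
    also have "\<dots> \<le> ennreal (lambda1 powr \<alpha> * (2 * (prob A - L2_inner M (P ?t ?f) ?f)))"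
      using flow by (intro ennreal_leI mult_left_mono) auto
    also have "\<dots> = ennreal (?t powr (- \<alpha>)) *
        (\<integral>\<^sup>+ y. (\<integral>\<^sup>+ x. ennreal \<bar>?f x - ?f y\<bar> \<partial>(p ?t y)) \<partial>M)"
      unfolding nn_integral_kernel_indicator[OF P assms(4,5) less_imp_le[OF t] A] powr
      by (simp add: ennreal_mult')
    \<comment> \<open>The supremum over all times is at least its value at
      \<open>?t\<close>.\<close>
    also have "\<dots> \<le> Besov_seminorm M p \<alpha> ?f"
      unfolding Besov_seminorm_def using t by (intro SUP_upper) simp
    finally have "ennreal ((1 - exp (- 1)) * lambda1 powr \<alpha>) * emeasure M A / emeasure M A
        \<le> Besov_seminorm M p \<alpha> ?f / emeasure M A"
      by (rule divide_right_mono_ennreal)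
    \<comment> \<open>Cancellation in the extended non-negative reals is legitimate because the
      measure of \<open>A\<close> is positive and finite.\<close>
    moreover have "ennreal ((1 - exp (- 1)) * lambda1 powr \<alpha>) * emeasure M A / emeasure M A
        = ennreal ((1 - exp (- 1)) * lambda1 powr \<alpha>)"
      using pos by (simp add: emeasure_eq_measure ennreal_mult[symmetric] divide_ennreal)
    ultimately show "ennreal ((1 - exp (- 1)) * lambda1 powr \<alpha>)
        \<le> Besov_seminorm M p \<alpha> ?f / emeasure M A" by simp
  qed
qed

end
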